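(* Let $\mu$ be an inhomogeneous Bernoulli product on $\Sigma=\{0,1\}^{\mathbb{N}}$. Suppose that the sequence $(\tau_{\mu,n}(q))_n$ converges at a point $q>0$. If $\tau_\mu'(q)$ exists and if $\alpha=-\tau_\mu'(q)$, then $$\dim\left(E_\alpha\cap F_\alpha\right)=\tau_\mu^*(\alpha)=\alpha q+\tau_\mu(q).$$
   Context: Let $\Sigma=\{0,1\}^{\mathbb{N}}$. For $\epsilon_1,\dots,\epsilon_n\in\{0,1\}$ the cylinder $I_{\epsilon_1\dots\epsilon_n}$ is the set of $x=(i_1,i_2,\dots)\in\Sigma$ with $i_1=\epsilon_1,\dots,i_n=\epsilon_n$. $\mathcal{F}_n$ is the collection of the $2^n$ cylinders of generation $n$; a cylinder $I\in\mathcal F_n$ has length (diameter) $|I|=2^{-n}$. For $x\in\Sigma$, $I_n(x)$ is the element of $\mathcal{F}_n$ containing $x$. $\dim$ denotes Hausdorff dimension with respect to this dyadic metric. An inhomogeneous Bernoulli product is a Borel probability measure $\mu$ on $\Sigma$ such that, for some sequence of weights $(p_n)_{n\ge1}$ with $p_n\in(0,1)$, $\mu(I_{\epsilon_1\dots\epsilon_n})=\prod_{j=1}^n p_j^{1-\epsilon_j}(1-p_j)^{\epsilon_j}$ for all $n$ and all $\epsilon_1,\dots,\epsilon_n\in\{0,1\}$. For $q\in\mathbb{R}$, $\tau_{\mu,n}(q)=\frac{1}{n\log 2}\log\left(\sum_{I\in\mathcal{F}_n}\mu(I)^q\right)$ and $\tau_\mu(q)=\limsup_{n\to\infty}\tau_{\mu,n}(q)$.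 The Legendre transform is $\tau_\mu^*(\alpha)=\inf_{q\in\mathbb{R}}(\alpha q+\tau_\mu(q))$. Put $\alpha_n(x)=-\frac{\log\mu(I_n(x))}{n\log 2}$. Then $E_\alpha=\{x\in\Sigma:\liminf_{n\to\infty}\alpha_n(x)=\alpha\}$ and $F_\alpha=\{x\in\Sigma:\limsup_{n\to\infty}\alpha_n(x)=\alpha\}$. *)

theory Defs
  imports "HOL-Probability.Probability"
begin

text \<open>
  The symbols \<open>0\<close>, \<open>1\<close> are \<open>False\<close>, \<open>True\<close>. Coordinates are counted
  from 0, so that the coordinate \<open>i\<^sub>j\<close> of \<open>x = (i\<^sub>1, i\<^sub>2, \<dots>)\<close> is \<open>x (j - 1)\<close>,
  and likewise for sequences of weights.
\<close>

type_synonym symb = "nat \<Rightarrow> bool"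

definition cylinder :: "bool list \<Rightarrow> symb set" where
  "cylinder w = {x. \<forall>j<length w. x j = w ! j}"

definition cylinders :: "nat \<Rightarrow> symb set set" where
  "cylinders n = cylinder ` {w. length w = n}"

definition cyl_at :: "nat \<Rightarrow> symb \<Rightarrow> symb set" where
  "cyl_at n x = cylinder (map x [0..<n])"

lemma mem_cyl_at_iff: "y \<in> cyl_at n x \<longleftrightarrow> (\<forall>j<n. y j = x j)"
  by (simp add: cyl_at_def cylinder_def)

lemma cyl_at_unique: "I = cyl_at n x \<longleftrightarrow> I \<in> cylinders n \<and> x \<in> I"
proof
  assume "I = cyl_at n x"
  then show "I \<in> cylinders n \<and> x \<in> I"
    by (simp add: mem_cyl_at_iff) (simp add: cyl_at_def cylinders_def)
next
  assume "I \<in> cylinders n \<and> x \<in> I"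
  then show "I = cyl_at n x"
    by (auto simp: cylinders_def mem_cyl_at_iff cylinder_def)
qed

text \<open>
  The exponent is the length of the longest common prefix of \<open>x\<close> and \<open>y\<close>; this gives
  the cylinders of generation \<open>n\<close> diameter \<open>2\<close> to the power \<open>-n\<close>, see
  \<open>ediam_cylinder\<close> below.
\<close>

definition dyadic_dist :: "symb \<Rightarrow> symb \<Rightarrow> real" where
  "dyadic_dist x y = (if x = y then 0 else (1 / 2) ^ (LEAST j. x j \<noteq> y j))"

definition ediam :: "('a \<Rightarrow> 'a \<Rightarrow> real) \<Rightarrow> 'a set \<Rightarrow> ennreal" where
  "ediam d U = (SUP x\<in>U. SUP y\<in>U. ennreal (d x y))"

text \<open>
  The \<open>s\<close>-th power of the diameter, with the usual conventions that the empty set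
  contributes \<open>0\<close> and that a nonempty set contributes \<open>1\<close> when \<open>s = 0\<close>
  (whereas \<open>0 powr 0 = 0\<close>). It is only applied to sets of finite diameter.
\<close>

definition diam_pow :: "('a \<Rightarrow> 'a \<Rightarrow> real) \<Rightarrow> real \<Rightarrow> 'a set \<Rightarrow> ennreal" where
  "diam_pow d s U =
     (if U = {} then 0 else if s = 0 then 1 else ennreal (enn2real (ediam d U) powr s))"

definition hausdorff_pre :: "('a \<Rightarrow> 'a \<Rightarrow> real) \<Rightarrow> real \<Rightarrow> real \<Rightarrow> 'a set \<Rightarrow> ennreal" where
  "hausdorff_pre d s \<delta> A =
     (INF U \<in> {U :: nat \<Rightarrow> 'a set. A \<subseteq> (\<Union>i. U i) \<and> (\<forall>i. ediam d (U i) \<le> ennreal \<delta>)}.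
        \<Sum>i. diam_pow d s (U i))"

definition hausdorff_measure :: "('a \<Rightarrow> 'a \<Rightarrow> real) \<Rightarrow> real \<Rightarrow> 'a set \<Rightarrow> ennreal" where
  "hausdorff_measure d s A = (SUP \<delta> \<in> {0<..}. hausdorff_pre d s \<delta> A)"

definition hausdorff_dim :: "('a \<Rightarrow> 'a \<Rightarrow> real) \<Rightarrow> 'a set \<Rightarrow> ereal" where
  "hausdorff_dim d A = Inf {ereal s | s. 0 \<le> s \<and> hausdorff_measure d s A = 0}"

lemma dyadic_dist_le_iff: "dyadic_dist x y \<le> (1 / 2) ^ n \<longleftrightarrow> y \<in> cyl_at n x"
proof (cases "x = y")
  case False
  then obtain k where k: "x k \<noteq> y k" by auto
  let ?m = "LEAST j. x j \<noteq> y j"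
  have m: "x ?m \<noteq> y ?m" using k by (rule LeastI)
  have lt: "x j = y j" if "j < ?m" for j using not_less_Least[OF that] by simp
  have "dyadic_dist x y \<le> (1 / 2) ^ n \<longleftrightarrow> n \<le> ?m"
    using False unfolding dyadic_dist_def by (simp add: power_decreasing_iff)
  also have "\<dots> \<longleftrightarrow> y \<in> cyl_at n x"
  proof
    assume "n \<le> ?m"
    then show "y \<in> cyl_at n x"
      unfolding mem_cyl_at_iff by (metis lt less_le_trans)
  next
    assume "y \<in> cyl_at n x"
    then show "n \<le> ?m"
      unfolding mem_cyl_at_iff by (metis m leI)
  qed
  finally show ?thesis .
qed (simp add: dyadic_dist_def mem_cyl_at_iff)

lemma Metric_space_dyadic_dist: "Metric_space UNIV dyadic_dist"
proof
  fix x y z :: symb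
  show "0 \<le> dyadic_dist x y" by (simp add: dyadic_dist_def)
  show "dyadic_dist x y = dyadic_dist y x"
    unfolding dyadic_dist_def by (simp only: eq_commute[of x y] eq_commute[of "x _" "y _"])
  show "dyadic_dist x y = 0 \<longleftrightarrow> x = y" by (simp add: dyadic_dist_def)
  show "dyadic_dist x z \<le> dyadic_dist x y + dyadic_dist y z"
  proof (cases "x = y \<or> y = z")
    case True
    then show ?thesis by (auto simp: dyadic_dist_def)
  next
    case False
    let ?a = "LEAST j. x j \<noteq> y j" and ?b = "LEAST j. y j \<noteq> z j"
    let ?n = "min ?a ?b"
    have a: "dyadic_dist x y = (1 / 2) ^ ?a" and b: "dyadic_dist y z = (1 / 2) ^ ?b"
      using False by (simp_all add: dyadic_dist_def)
    have "y \<in> cyl_at ?a x" "z \<in> cyl_at ?b y"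
      using dyadic_dist_le_iff[of x y ?a] dyadic_dist_le_iff[of y z ?b] a b by simp_all
    then have "\<forall>j<?n. z j = x j" unfolding mem_cyl_at_iff by (metis min_less_iff_conj)
    then have "z \<in> cyl_at ?n x" unfolding mem_cyl_at_iff .
    then have "dyadic_dist x z \<le> (1 / 2) ^ ?n" by (rule iffD2[OF dyadic_dist_le_iff])
    also have "\<dots> \<le> (1 / 2) ^ ?a + (1 / 2) ^ ?b" unfolding min_def by (cases "?a \<le> ?b") simp_all
    finally show ?thesis using a b by simp
  qed
qed

lemma ediam_cylinder: "ediam dyadic_dist (cylinder w) = ennreal ((1 / 2) ^ length w)"
proof (rule antisym)
  show "ediam dyadic_dist (cylinder w) \<le> ennreal ((1 / 2) ^ length w)"
    unfolding ediam_def
    by (intro SUP_least ennreal_leI)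
       (simp add: dyadic_dist_le_iff mem_cyl_at_iff cylinder_def)
next
  let ?n = "length w"
  define x y where "x = (\<lambda>j. if j < ?n then w ! j else False)"
    and "y = (\<lambda>j. if j < ?n then w ! j else True)"
  have mem: "x \<in> cylinder w" "y \<in> cylinder w"
    by (auto simp: x_def y_def cylinder_def)
  have ne: "x \<noteq> y" by (auto simp: x_def y_def fun_eq_iff)
  have "(LEAST j. x j \<noteq> y j) = ?n"
    by (rule Least_equality) (auto simp: x_def y_def split: if_splits intro: leI)
  then have "dyadic_dist x y = (1 / 2) ^ ?n" using ne by (simp add: dyadic_dist_def)
  then show "ennreal ((1 / 2) ^ ?n) \<le> ediam dyadic_dist (cylinder w)"
    unfolding ediam_def by (intro SUP_upper2[OF mem(1)] SUP_upper2[OF mem(2)]) simp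
qed

text \<open>
  \<open>borel\<close> refers to the product topology on \<open>nat \<Rightarrow> bool\<close>, which is the topology
  of the dyadic metric.
\<close>

definition bernoulli_product :: "symb measure \<Rightarrow> bool" where
  "bernoulli_product \<mu> \<longleftrightarrow>
     prob_space \<mu> \<and> sets \<mu> = sets borel \<and>
     (\<exists>p :: nat \<Rightarrow> real.
        (\<forall>n. 0 < p n \<and> p n < 1) \<and>
        (\<forall>w. measure \<mu> (cylinder w) =
               (\<Prod>j<length w. p j ^ (1 - of_bool (w ! j)) * (1 - p j) ^ of_bool (w ! j))))"

definition tau_n :: "symb measure \<Rightarrow> nat \<Rightarrow> real \<Rightarrow> real" where
  "tau_n \<mu> n q = 1 / (real n * ln 2) * ln (\<Sum>I\<in>cylinders n. measure \<mu> I powr q)"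

text \<open>The upper limit can be infinite when \<open>q < 0\<close>, since the weights may approach 0 or 1.\<close>

definition tau :: "symb measure \<Rightarrow> real \<Rightarrow> ereal" where
  "tau \<mu> q = limsup (\<lambda>n. ereal (tau_n \<mu> n q))"

definition legendre :: "(real \<Rightarrow> ereal) \<Rightarrow> real \<Rightarrow> ereal" where
  "legendre f \<alpha> = (INF q. ereal (\<alpha> * q) + f q)"

text \<open>
  \<open>tau\<close> is finite on \<open>q \<ge> 0\<close>, so that at a point \<open>q > 0\<close> this real-valued version
  is the right function to differentiate.
\<close>

definition tau_real :: "symb measure \<Rightarrow> real \<Rightarrow> real" where
  "tau_real \<mu> q = real_of_ereal (tau \<mu> q)"

definition alpha_n :: "symb measure \<Rightarrow> nat \<Rightarrow> symb \<Rightarrow> real" where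
  "alpha_n \<mu> n x = - (ln (measure \<mu> (cyl_at n x)) / (real n * ln 2))"

definition E_set :: "symb measure \<Rightarrow> real \<Rightarrow> symb set" where
  "E_set \<mu> \<alpha> = {x. liminf (\<lambda>n. ereal (alpha_n \<mu> n x)) = ereal \<alpha>}"

definition F_set :: "symb measure \<Rightarrow> real \<Rightarrow> symb set" where
  "F_set \<mu> \<alpha> = {x. limsup (\<lambda>n. ereal (alpha_n \<mu> n x)) = ereal \<alpha>}"

end

theory Submission
  imports Defs
begin

text \<open>
  The proof compares \<open>\<mu>\<close> with the tilted (Gibbs) measure \<open>\<nu>\<close>, the Bernoulli product whose weights are
  \<open>p\<^sub>j\<close> to the power \<open>q\<close> and \<open>1 - p\<^sub>j\<close> to the power \<open>q\<close>, normalised by their sum. On a cylinder \<open>I\<close> of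
  generation \<open>n\<close> it equals \<open>\<mu> I powr q / 2 powr (n * tau_n \<mu> n q)\<close>; therefore
  \<open>alpha_n \<nu> n x = q * alpha_n \<mu> n x + tau_n \<mu> n q\<close> (lemma \<open>alpha_n_tilted\<close>).

  Exponential moments of \<open>ln \<mu>\<close> under \<open>\<nu>\<close> are partition functions:
  \<open>\<nu> {x. t * alpha_n \<mu> n x \<le> b}\<close> is at most 2 to the power
  \<open>n * (tau_n \<mu> n (q + t) - tau_n \<mu> n q + b)\<close> (lemma \<open>chernoff\<close>). As \<open>tau_n \<mu> n q\<close> converges to some \<open>T\<close>,
  and \<open>tau \<mu>\<close> dominates \<open>tau_n \<mu> n\<close> asymptotically and has derivative \<open>- \<alpha>\<close> at \<open>q\<close>, small \<open>t\<close> of both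
  signs show that \<open>\<nu> {x. \<epsilon> \<le> \<bar>alpha_n \<mu> n x - \<alpha>\<bar>}\<close> decays exponentially (lemma \<open>deviation_decay\<close>).
  This has two consequences.

  First, by Borel-Cantelli, \<open>alpha_n \<mu> n x\<close> tends to \<open>\<alpha>\<close> for \<open>\<nu>\<close>-almost every \<open>x\<close>. The set of all \<open>x\<close> with
  this property is \<open>E_set \<mu> \<alpha> \<inter> F_set \<mu> \<alpha>\<close>; it has full \<open>\<nu>\<close>-measure, and the local dimension of \<open>\<nu>\<close> equals
  \<open>\<alpha> * q + T\<close> at each of its points. By Billingsley's theorem (lemma \<open>hausdorff_dim_eq_local_dim\<close>) this
  number is its Hausdorff dimension.

  Second, at least half of the mass of \<open>\<nu>\<close> sits on cylinders where \<open>alpha_n \<mu> n\<close> is close to \<open>\<alpha>\<close>.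
  Restricting the partition function at an arbitrary \<open>q'\<close> to these gives the tangent inequality
  \<open>T - \<alpha> * (q' - q) \<le> tau \<mu> q'\<close> (lemma \<open>tau_tangent\<close>), without appeal to convexity. It says that
  the infimum in the Legendre transform is attained at \<open>q\<close>.
\<close>

section \<open>Cylinders\<close>

lemma finite_cylinders: "finite (cylinders n)"
proof -
  have "finite {w::bool list. length w = n}"
    using finite_lists_length_eq[of "UNIV::bool set" n] by simp
  then show ?thesis unfolding cylinders_def by (rule finite_imageI)
qed

lemma card_cylinders_le: "card (cylinders n) \<le> 2 ^ n"
proof -
  have f: "finite {w::bool list. length w = n}"
    using finite_lists_length_eq[of "UNIV::bool set" n] by simp
  have "card (cylinders n) \<le> card {w::bool list. length w = n}"
    unfolding cylinders_def using f by (rule card_image_le)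
  also have "\<dots> = 2 ^ n"
    using card_lists_length_eq[of "UNIV::bool set" n] by simp
  finally show ?thesis .
qed

lemma cyl_at_in_cylinders [simp]: "cyl_at n x \<in> cylinders n"
  by (rule conjunct1[OF iffD1[OF cyl_at_unique refl]])

lemma cylinders_D:
  assumes "I \<in> cylinders n"
  shows "\<exists>x. I = cyl_at n x"
proof -
  obtain w where "I = cylinder w" "length w = n" using assms by (auto simp: cylinders_def)
  then have "(\<lambda>j. if j < n then w ! j else False) \<in> I" by (simp add: cylinder_def)
  then show ?thesis using assms cyl_at_unique by blast
qed

lemma disjoint_cylinders: "disjoint (cylinders n)"
proof (rule disjointI)
  fix I J assume IJ: "I \<in> cylinders n" "J \<in> cylinders n" "I \<noteq> J"
  have "I = J" if x: "x \<in> I" "x \<in> J" for x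
    using iffD2[OF cyl_at_unique, of I n x] iffD2[OF cyl_at_unique, of J n x] IJ x by simp
  then show "I \<inter> J = {}" using IJ by blast
qed

lemma Collect_cyl_at: "{x. P (cyl_at n x)} = \<Union>{I \<in> cylinders n. P I}"
proof -
  have "x \<in> I \<longleftrightarrow> I = cyl_at n x" if "I \<in> cylinders n" for x I
    using that cyl_at_unique by blast
  then show ?thesis by auto
qed

lemma inj_on_cylinder: "inj_on cylinder {w. length w = n}"
proof (rule inj_onI)
  fix v w :: "bool list"
  assume vw: "v \<in> {w. length w = n}" "w \<in> {w. length w = n}" "cylinder v = cylinder w"
  have "(\<lambda>j. if j < n then v ! j else False) \<in> cylinder v"
    using vw(1) by (simp add: cylinder_def)
  then have "(\<lambda>j. if j < n then v ! j else False) \<in> cylinder w" by (simp only: vw(3))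
  then have "\<forall>j<n. v ! j = w ! j" using vw(2) by (simp add: cylinder_def)
  then show "v = w" using vw(1,2) by (simp add: nth_equalityI)
qed

lemma sum_cylinders: "(\<Sum>I\<in>cylinders n. f I) = (\<Sum>w | length w = n. f (cylinder w))"
  unfolding cylinders_def using sum.reindex[OF inj_on_cylinder, of f] by simp

lemma diam_pow_cylinder:
  "diam_pow dyadic_dist s (cylinder w) = ennreal (2 powr (- real (length w) * s))"
proof -
  have "(\<lambda>j. w ! j) \<in> cylinder w" by (simp add: cylinder_def)
  then have ne: "cylinder w \<noteq> {}" by blast
  have "((1 / 2) ^ length w :: real) = 2 powr (- real (length w))"
    by (simp add: powr_minus powr_realpow power_divide divide_simps)
  then have "((1 / 2) ^ length w) powr s = 2 powr (- real (length w) * s)"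
    by (simp only: powr_powr)
  then show ?thesis using ne
    by (simp add: diam_pow_def ediam_cylinder)
qed

text \<open>
  Generation \<open>0\<close> is included: division by zero makes \<open>alpha_n \<mu> 0 x = 0\<close>, which agrees with total
  mass 1.
\<close>

lemma measure_cyl_at_alpha_n:
  assumes "measure \<mu> (cyl_at n x) > 0" and "measure \<mu> UNIV = 1"
  shows "measure \<mu> (cyl_at n x) = 2 powr (- (real n * alpha_n \<mu> n x))"
proof (cases "n = 0")
  case True
  then have "cyl_at n x = UNIV" by (auto simp: mem_cyl_at_iff)
  then show ?thesis using True assms by simp
next
  case False
  then have "ln (measure \<mu> (cyl_at n x)) = - (real n * alpha_n \<mu> n x) * ln 2"
    by (simp add: alpha_n_def)
  then show ?thesis using assms(1) by (metis exp_ln powr_def zero_neq_numeral)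
qed

section \<open>Hausdorff dimension and local dimension of a measure\<close>

text \<open>
  A probability measure on the sequence space for which cylinders are measurable. The \<open>\<sigma>\<close>-algebra is
  left open, so that no identification of the product \<open>\<sigma>\<close>-algebra with the Borel one is needed.
\<close>

locale symb_prob_space = prob_space \<nu> for \<nu> :: "symb measure" +
  assumes space_symb: "space \<nu> = UNIV"
    and cylinder_sets: "cylinder w \<in> sets \<nu>"
begin

lemma cylinders_sets: "I \<in> cylinders n \<Longrightarrow> I \<in> sets \<nu>"
  by (auto simp: cylinders_def cylinder_sets)

lemma cyl_at_sets: "cyl_at n x \<in> sets \<nu>"
  by (rule cylinders_sets[OF cyl_at_in_cylinders])

lemma Collect_cyl_at_sets: "{x. P (cyl_at n x)} \<in> sets \<nu>"
  unfolding Collect_cyl_at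
  by (rule sets.finite_Union) (auto simp: finite_cylinders cylinders_sets)

lemma measure_Collect_cyl_at:
  "measure \<nu> {x. P (cyl_at n x)} = (\<Sum>I | I \<in> cylinders n \<and> P I. measure \<nu> I)"
proof -
  have "measure \<nu> (\<Union>i\<in>{I \<in> cylinders n. P I}. i)
      = (\<Sum>I\<in>{I \<in> cylinders n. P I}. measure \<nu> I)"
    using disjoint_cylinders[of n]
    by (intro finite_measure_finite_Union)
       (auto simp: finite_cylinders cylinders_sets disjoint_family_on_def disjoint_def)
  then show ?thesis by (simp add: Collect_cyl_at)
qed

lemma sum_measure_cylinders: "(\<Sum>I\<in>cylinders n. measure \<nu> I) = 1"
  using measure_Collect_cyl_at[of "\<lambda>_. True" n] prob_space by (simp add: space_symb)

text \<open>
  Upper half of Billingsley's theorem: the cylinders of generation at least \<open>N\<close> on which \<open>\<nu>\<close> is large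
  cover \<open>A\<close>, and in each generation the total mass 1 of \<open>\<nu>\<close> bounds their contribution.
\<close>

lemma hausdorff_measure_eq_0:
  assumes ut: "u < t"
    and A: "\<And>x. x \<in> A \<Longrightarrow> \<exists>\<^sub>F n in sequentially. 2 powr (- real n * u) \<le> measure \<nu> (cyl_at n x)"
  shows "hausdorff_measure dyadic_dist t A = 0"
proof -
  define \<kappa> where "\<kappa> = (t - u) / 2"
  have \<kappa>: "\<kappa> > 0" using ut by (simp add: \<kappa>_def)
  define r :: real where "r = 2 powr (- \<kappa>)"
  have r: "0 < r" "r < 1" using \<kappa> powr_less_mono[of "- \<kappa>" 0 2] by (simp_all add: r_def)
  define good where "good w \<longleftrightarrow> 2 powr (- real (length w) * u) \<le> measure \<nu> (cylinder w)" for w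
  let ?L = "count_space (UNIV :: bool list set)"
  let ?e = "from_nat_into (UNIV :: bool list set)"
  have bij: "bij_betw ?e UNIV UNIV"
    by (rule bij_betw_from_nat_into) (simp_all add: infinite_UNIV_listI)
  have total: "(\<integral>\<^sup>+w. ennreal (measure \<nu> (cylinder w) * r ^ length w) \<partial>?L) = ennreal (1 / (1 - r))"
  proof -
    let ?g = "\<lambda>n w. ennreal (measure \<nu> (cylinder w) * r ^ length w) * indicator {w. length w = n} w"
    have fin: "finite {w::bool list. length w = n}" for n
      using finite_lists_length_eq[of "UNIV::bool set" n] by simp
    have split: "ennreal (measure \<nu> (cylinder w) * r ^ length w) = (\<Sum>n. ?g n w)" for w
    proof -
      have "(\<Sum>n. ?g n w) = (\<Sum>n\<in>{length w}. ?g n w)"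
        by (rule suminf_finite) auto
      then show ?thesis by simp
    qed
    have level: "(\<integral>\<^sup>+w. ?g n w \<partial>?L) = ennreal (r ^ n)" for n
    proof -
      have "(\<integral>\<^sup>+w. ?g n w \<partial>?L) = (\<Sum>w | length w = n. ?g n w)"
        by (rule nn_integral_count_space'[OF fin]) auto
      also have "\<dots> = (\<Sum>w | length w = n. ennreal (measure \<nu> (cylinder w) * r ^ n))"
        by (rule sum.cong) auto
      also have "\<dots> = ennreal (\<Sum>w | length w = n. measure \<nu> (cylinder w) * r ^ n)"
        using r by (intro sum_ennreal) auto
      also have "(\<Sum>w | length w = n. measure \<nu> (cylinder w) * r ^ n) = r ^ n"
        using sum_measure_cylinders[of n] by (simp add: sum_cylinders flip: sum_distrib_right)
      finally show ?thesis .
    qed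
    have "(\<integral>\<^sup>+w. ennreal (measure \<nu> (cylinder w) * r ^ length w) \<partial>?L) = (\<integral>\<^sup>+w. (\<Sum>n. ?g n w) \<partial>?L)"
      by (intro nn_integral_cong split)
    also have "\<dots> = (\<Sum>n. \<integral>\<^sup>+w. ?g n w \<partial>?L)"
      by (rule nn_integral_suminf) simp
    also have "\<dots> = (\<Sum>n. ennreal (r ^ n))" by (simp only: level)
    also have "(\<Sum>n. ennreal (r ^ n)) = ennreal (\<Sum>n. r ^ n)"
      using r by (intro suminf_ennreal2 summable_geometric) auto
    also have "(\<Sum>n. r ^ n) = 1 / (1 - r)" using r by (intro suminf_geometric) auto
    finally show ?thesis .
  qed
  have pre: "hausdorff_pre dyadic_dist t \<delta> A \<le> ennreal (r ^ N) * ennreal (1 / (1 - r))"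
    if N: "(1 / 2) ^ N \<le> \<delta>" for \<delta> N
  proof -
    define V where "V w = (if N \<le> length w \<and> good w then cylinder w else {})" for w
    have cover: "A \<subseteq> (\<Union>i. V (?e i))"
    proof
      fix x assume "x \<in> A"
      from A[OF this] obtain n where n: "n \<ge> N" "2 powr (- real n * u) \<le> measure \<nu> (cyl_at n x)"
        by (auto simp: frequently_sequentially)
      have "x \<in> V (map x [0..<n])"
        using n by (auto simp: V_def good_def cyl_at_def cylinder_def)
      moreover obtain i where "?e i = map x [0..<n]"
        using bij by (metis UNIV_I bij_betw_imp_surj_on imageE)
      ultimately show "x \<in> (\<Union>i. V (?e i))" by (metis UN_I UNIV_I)
    qed
    have small: "ediam dyadic_dist (V w) \<le> ennreal \<delta>" for w
    proof (cases "N \<le> length w \<and> good w")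
      case True
      have "(1 / 2) ^ length w \<le> ((1 / 2) ^ N :: real)"
        using True by (intro power_decreasing) auto
      also note N
      finally show ?thesis using True by (simp add: V_def ediam_cylinder ennreal_leI)
    next
      case False
      then have "V w = {}" by (auto simp: V_def)
      then show ?thesis by (simp add: ediam_def bot_ennreal)
    qed
    have bound: "diam_pow dyadic_dist t (V w)
        \<le> ennreal (r ^ N) * ennreal (measure \<nu> (cylinder w) * r ^ length w)" for w
    proof (cases "N \<le> length w \<and> good w")
      case True
      let ?n = "length w"
      \<comment> \<open>Half of the exponent gap \<open>t - u\<close> makes the series over all words converge, the other
        half makes its tail small.\<close>
      have "2 powr (- real ?n * t) = 2 powr (- real ?n * u) * (2 powr (- \<kappa> * real ?n) * 2 powr (- \<kappa> * real ?n))"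
        by (simp add: \<kappa>_def field_simps flip: powr_add)
      also have "\<dots> = 2 powr (- real ?n * u) * (r ^ ?n * r ^ ?n)"
        by (simp add: r_def powr_powr flip: powr_realpow)
      also have "\<dots> \<le> measure \<nu> (cylinder w) * (r ^ ?n * r ^ N)"
        using True r by (intro mult_mono power_decreasing) (auto simp: good_def)
      finally show ?thesis
        using True r by (simp add: V_def diam_pow_cylinder ennreal_leI mult_ac flip: ennreal_mult)
    next
      case False
      then have "V w = {}" by (auto simp: V_def)
      then show ?thesis by (simp add: diam_pow_def)
    qed
    have "hausdorff_pre dyadic_dist t \<delta> A \<le> (\<Sum>i. diam_pow dyadic_dist t (V (?e i)))"
      unfolding hausdorff_pre_def using cover small by (intro INF_lower) simp
    also have "\<dots> = (\<integral>\<^sup>+i. diam_pow dyadic_dist t (V (?e i)) \<partial>count_space UNIV)"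
      by (simp add: nn_integral_count_space_nat)
    also have "\<dots> = (\<integral>\<^sup>+w. diam_pow dyadic_dist t (V w) \<partial>?L)"
      by (rule nn_integral_bij_count_space[OF bij])
    also have "\<dots> \<le> (\<integral>\<^sup>+w. ennreal (r ^ N) * ennreal (measure \<nu> (cylinder w) * r ^ length w) \<partial>?L)"
      by (rule nn_integral_mono) (rule bound)
    also have "\<dots> = ennreal (r ^ N) * ennreal (1 / (1 - r))"
      by (simp add: nn_integral_cmult total)
    finally show ?thesis .
  qed
  have "hausdorff_pre dyadic_dist t \<delta> A = 0" if \<delta>: "\<delta> > 0" for \<delta>
  proof -
    have "(\<lambda>N. ennreal (r ^ N * (1 / (1 - r)))) \<longlonglongrightarrow> ennreal (0 * (1 / (1 - r)))"
      using r by (intro tendsto_ennrealI tendsto_mult_right LIMSEQ_realpow_zero) auto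
    moreover have "\<forall>\<^sub>F N in sequentially. (1 / 2) ^ N \<le> \<delta>"
    proof -
      have "(\<lambda>N. (1 / 2 :: real) ^ N) \<longlonglongrightarrow> 0" by (rule LIMSEQ_realpow_zero) auto
      from order_tendstoD(2)[OF this \<delta>] show ?thesis by eventually_elim simp
    qed
    then have "\<forall>\<^sub>F N in sequentially. hausdorff_pre dyadic_dist t \<delta> A \<le> ennreal (r ^ N * (1 / (1 - r)))"
    proof eventually_elim
      case (elim N)
      show ?case using pre[OF elim] r by (simp flip: ennreal_mult)
    qed
    ultimately have "hausdorff_pre dyadic_dist t \<delta> A \<le> ennreal (0 * (1 / (1 - r)))"
      by (intro tendsto_lowerbound) auto
    then show ?thesis by simp
  qed
  then show ?thesis unfolding hausdorff_measure_def
    by (simp add: bot_ennreal)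
qed

text \<open>
  The covering sets in the definition of the Hausdorff measure are arbitrary. A set \<open>U\<close> containing a
  point \<open>x\<close> at which \<open>\<nu>\<close> decays lies in the cylinder around \<open>x\<close> whose diameter is the smallest power
  of \<open>1/2\<close> not below that of \<open>U\<close>; this costs a factor \<open>2 powr t\<close>. If \<open>U\<close> has diameter \<open>0\<close>, it is
  the singleton of \<open>x\<close>, a null set when \<open>t > 0\<close>; when \<open>t = 0\<close> the whole space serves as \<open>V\<close>.
\<close>

lemma cover_by_diam_pow:
  assumes t: "t \<ge> 0" and U: "ediam dyadic_dist U \<le> ennreal ((1 / 2) ^ N)"
  shows "\<exists>V\<in>sets \<nu>. U \<inter> {x. \<forall>n\<ge>N. measure \<nu> (cyl_at n x) \<le> 2 powr (- real n * t)} \<subseteq> V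
           \<and> emeasure \<nu> V \<le> ennreal (2 powr t) * diam_pow dyadic_dist t U"
proof (cases "U \<inter> {x. \<forall>n\<ge>N. measure \<nu> (cyl_at n x) \<le> 2 powr (- real n * t)} = {}")
  case True
  then show ?thesis by (intro bexI[of _ "{}"]) auto
next
  case False
  then obtain x where x: "x \<in> U"
    and xle: "\<And>n. n \<ge> N \<Longrightarrow> measure \<nu> (cyl_at n x) \<le> 2 powr (- real n * t)" by auto
  define D where "D = enn2real (ediam dyadic_dist U)"
  have fin: "ediam dyadic_dist U = ennreal D"
    using U unfolding D_def by (metis ennreal_enn2real ennreal_less_top infinity_ennreal_def order_le_less_trans)
  have D0: "D \<ge> 0" by (simp add: D_def)
  have DN: "D \<le> (1 / 2) ^ N" using U fin D0 by (simp add: ennreal_le_iff)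
  have dist: "dyadic_dist x y \<le> D" if "y \<in> U" for y
  proof -
    have "ennreal (dyadic_dist x y) \<le> ediam dyadic_dist U"
      unfolding ediam_def by (intro SUP_upper2[OF x] SUP_upper2[OF that]) simp
    then show ?thesis using fin D0 by (simp add: ennreal_le_iff)
  qed
  have sub: "U \<subseteq> cyl_at m x" if "D \<le> (1 / 2) ^ m" for m
    using dist that by (meson dyadic_dist_le_iff order_trans subsetI)
  consider "t = 0" | "t > 0" "D = 0" | "t > 0" "D > 0" using t D0 by linarith
  then show ?thesis
  proof cases
    case 1
    then have "diam_pow dyadic_dist t U = 1" using x by (auto simp: diam_pow_def)
    then show ?thesis using 1 emeasure_space_1
      by (intro bexI[of _ "space \<nu>"]) (simp_all, simp add: space_symb)
  next
    case 2
    let ?V = "\<Inter>m. cyl_at m x"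
    have V: "?V \<in> sets \<nu>" using cyl_at_sets by (intro sets.countable_INT') auto
    have "measure \<nu> ?V \<le> 0"
    proof (rule tendsto_lowerbound)
      have "(\<lambda>n. (2 powr (- t)) ^ n) \<longlonglongrightarrow> 0"
        using 2 powr_less_mono[of "- t" 0 2] by (intro LIMSEQ_realpow_zero) simp_all
      then show "(\<lambda>n. 2 powr (- real n * t)) \<longlonglongrightarrow> 0"
        by (simp add: powr_powr mult.commute flip: powr_realpow)
      show "\<forall>\<^sub>F n in sequentially. measure \<nu> ?V \<le> 2 powr (- real n * t)"
        using eventually_ge_at_top[of N]
      proof eventually_elim
        case (elim n)
        have "measure \<nu> ?V \<le> measure \<nu> (cyl_at n x)"
          using cyl_at_sets by (intro finite_measure_mono) auto
        then show ?case using xle[OF elim] by simp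
      qed
    qed simp
    then have "emeasure \<nu> ?V = 0" by (simp add: emeasure_eq_measure measure_le_0_iff)
    moreover have "U \<subseteq> ?V" using sub 2 by auto
    ultimately show ?thesis using V by (intro bexI[of _ ?V]) auto
  next
    case 3
    obtain k0 where "(1 / 2) ^ k0 < D" using real_arch_pow_inv[of D "1/2"] 3 by auto
    define k where "k = (LEAST k. (1 / 2) ^ k < D)"
    have lt: "(1 / 2) ^ k < D" unfolding k_def by (rule LeastI) fact
    have "k > N"
    proof (rule ccontr)
      assume "\<not> k > N"
      then have "(1 / 2 :: real) ^ N \<le> (1 / 2) ^ k" by (intro power_decreasing) auto
      then show False using lt DN by linarith
    qed
    then obtain m where m: "k = Suc m" "m \<ge> N" by (cases k) auto
    have Dm: "D \<le> (1 / 2) ^ m"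
      using not_less_Least[of m "\<lambda>k. (1 / 2) ^ k < D"] m by (simp add: k_def[symmetric])
    have "measure \<nu> (cyl_at m x) \<le> 2 powr (- real m * t)" using xle m by simp
    also have "\<dots> = 2 powr t * (2 powr (- real k)) powr t"
      by (simp add: m powr_powr algebra_simps flip: powr_add)
    also have "2 powr (- real k) = (1 / 2) ^ k"
      by (simp add: powr_minus powr_realpow power_divide divide_simps)
    also have "2 powr t * ((1 / 2) ^ k) powr t \<le> 2 powr t * D powr t"
      using lt t by (intro mult_left_mono powr_mono2) auto
    finally have "emeasure \<nu> (cyl_at m x) \<le> ennreal (2 powr t) * diam_pow dyadic_dist t U"
      using x 3 by (auto simp: diam_pow_def emeasure_eq_measure D_def[symmetric] ennreal_leI
          simp flip: ennreal_mult)
    then show ?thesis using sub[OF Dm] cyl_at_sets by (intro bexI[of _ "cyl_at m x"]) auto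
  qed
qed

text \<open>Lower half of Billingsley's theorem, the mass distribution principle.\<close>

lemma hausdorff_measure_neq_0:
  assumes t: "t \<ge> 0" and A: "AE x in \<nu>. x \<in> A"
    and decay: "AE x in \<nu>. \<forall>\<^sub>F n in sequentially. measure \<nu> (cyl_at n x) \<le> 2 powr (- real n * t)"
  shows "hausdorff_measure dyadic_dist t A \<noteq> 0"
proof -
  define c where "c N = {x. \<forall>n\<ge>N. measure \<nu> (cyl_at n x) \<le> 2 powr (- real n * t)}" for N
  have c_sets: "c N \<in> sets \<nu>" for N
  proof -
    have "c N = (\<Inter>n. {x. n \<ge> N \<longrightarrow> measure \<nu> (cyl_at n x) \<le> 2 powr (- real n * t)})"
      by (auto simp: c_def)
    also have "\<dots> \<in> sets \<nu>"
      using Collect_cyl_at_sets by (intro sets.countable_INT') auto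
    finally show ?thesis .
  qed
  \<comment> \<open>The sets \<open>c N\<close> cover almost every point, so one of them has positive mass.\<close>
  have "\<exists>N. emeasure \<nu> (c N) \<noteq> 0"
  proof (rule ccontr)
    assume "\<nexists>N. emeasure \<nu> (c N) \<noteq> 0"
    then have "AE x in \<nu>. x \<notin> c N" for N
      using c_sets by (intro AE_not_in) (auto simp: null_sets_def)
    then have "AE x in \<nu>. \<forall>N. x \<notin> c N" by (simp add: AE_all_countable)
    with decay have "AE x in \<nu>. False"
    proof eventually_elim
      case (elim x)
      then show ?case by (auto simp: eventually_sequentially c_def)
    qed
    then show False by simp
  qed
  then obtain N where N: "emeasure \<nu> (c N) \<noteq> 0" by auto
  have "ennreal (2 powr (- t)) * emeasure \<nu> (c N) \<le> (\<Sum>i. diam_pow dyadic_dist t (U i))"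
    if U: "A \<subseteq> (\<Union>i. U i)" "\<forall>i. ediam dyadic_dist (U i) \<le> ennreal ((1 / 2) ^ N)" for U
  proof -
    have "\<forall>i. \<exists>V\<in>sets \<nu>. U i \<inter> c N \<subseteq> V
           \<and> emeasure \<nu> V \<le> ennreal (2 powr t) * diam_pow dyadic_dist t (U i)"
      unfolding c_def using cover_by_diam_pow[OF t] U(2) by blast
    then obtain V where V: "\<And>i. V i \<in> sets \<nu>" "\<And>i. U i \<inter> c N \<subseteq> V i"
      "\<And>i. emeasure \<nu> (V i) \<le> ennreal (2 powr t) * diam_pow dyadic_dist t (U i)" by metis
    have "emeasure \<nu> (c N) \<le> emeasure \<nu> (\<Union>i. V i)"
    proof (rule emeasure_mono_AE)
      show "AE x in \<nu>. x \<in> c N \<longrightarrow> x \<in> (\<Union>i. V i)"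
        using A by eventually_elim (use U(1) V(2) in blast)
      show "(\<Union>i. V i) \<in> sets \<nu>" using V(1) by auto
    qed
    also have "\<dots> \<le> (\<Sum>i. emeasure \<nu> (V i))"
      using V(1) by (intro emeasure_subadditive_countably) auto
    also have "\<dots> \<le> (\<Sum>i. ennreal (2 powr t) * diam_pow dyadic_dist t (U i))"
      by (intro suminf_le V(3)) auto
    also have "\<dots> = ennreal (2 powr t) * (\<Sum>i. diam_pow dyadic_dist t (U i))"
      by simp
    finally have "ennreal (2 powr (- t)) * emeasure \<nu> (c N)
        \<le> ennreal (2 powr (- t)) * (ennreal (2 powr t) * (\<Sum>i. diam_pow dyadic_dist t (U i)))"
      by (rule mult_left_mono) simp
    also have "\<dots> = (\<Sum>i. diam_pow dyadic_dist t (U i))"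
      by (simp flip: mult.assoc ennreal_mult powr_add)
    finally show ?thesis .
  qed
  then have lower: "ennreal (2 powr (- t)) * emeasure \<nu> (c N) \<le> hausdorff_pre dyadic_dist t ((1 / 2) ^ N) A"
    unfolding hausdorff_pre_def by (intro INF_greatest) auto
  have "0 < ennreal (2 powr (- t)) * emeasure \<nu> (c N)"
    using N by (simp add: ennreal_zero_less_mult_iff zero_less_iff_neq_zero)
  also note lower
  also have "hausdorff_pre dyadic_dist t ((1 / 2) ^ N) A \<le> hausdorff_measure dyadic_dist t A"
    unfolding hausdorff_measure_def by (intro SUP_upper) simp
  finally show ?thesis by simp
qed

text \<open>
  Billingsley's theorem for a constant local dimension; \<open>alpha_n \<nu> n x\<close> is the \<open>n\<close>-th approximation of
  the local dimension of \<open>\<nu>\<close> at \<open>x\<close>.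
\<close>

lemma hausdorff_dim_eq_local_dim:
  assumes pos: "\<And>n x. measure \<nu> (cyl_at n x) > 0"
    and A: "AE x in \<nu>. x \<in> A"
    and lim: "\<And>x. x \<in> A \<Longrightarrow> (\<lambda>n. alpha_n \<nu> n x) \<longlonglongrightarrow> s"
  shows "hausdorff_dim dyadic_dist A = ereal s"
proof -
  have eq: "measure \<nu> (cyl_at n x) = 2 powr (- (real n * alpha_n \<nu> n x))" for n x
    using measure_cyl_at_alpha_n[OF pos] prob_space by (simp add: space_symb)
  have up: "hausdorff_measure dyadic_dist t A = 0" if "s < t" for t
  proof -
    obtain u where u: "s < u" "u < t" using \<open>s < t\<close> dense by blast
    have "\<exists>\<^sub>F n in sequentially. 2 powr (- real n * u) \<le> measure \<nu> (cyl_at n x)" if "x \<in> A" for x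
    proof (rule eventually_frequently)
      have "\<forall>\<^sub>F n in sequentially. alpha_n \<nu> n x < u"
        using lim[OF that] u by (intro order_tendstoD) auto
      then show "\<forall>\<^sub>F n in sequentially. 2 powr (- real n * u) \<le> measure \<nu> (cyl_at n x)"
        by eventually_elim (simp add: eq mult_left_mono)
    qed simp
    then show ?thesis using u(2) by (intro hausdorff_measure_eq_0)
  qed
  have low: "hausdorff_measure dyadic_dist t A \<noteq> 0" if "0 \<le> t" "t < s" for t
  proof (rule hausdorff_measure_neq_0[OF that(1) A])
    show "AE x in \<nu>. \<forall>\<^sub>F n in sequentially. measure \<nu> (cyl_at n x) \<le> 2 powr (- real n * t)"
      using A
    proof eventually_elim
      case (elim x)
      have "\<forall>\<^sub>F n in sequentially. t < alpha_n \<nu> n x"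
        using lim[OF elim] that by (intro order_tendstoD) auto
      then show ?case by eventually_elim (simp add: eq mult_left_mono)
    qed
  qed
  \<comment> \<open>Needed because the Hausdorff dimension only ranges over exponents \<open>t \<ge> 0\<close>.\<close>
  have s0: "0 \<le> s"
  proof -
    have "A \<noteq> {}"
    proof
      assume "A = {}"
      with A have "AE x in \<nu>. False" by simp
      then show False by simp
    qed
    then obtain x where x: "x \<in> A" by auto
    have "0 \<le> alpha_n \<nu> n x" for n
      using pos[of n x] by (simp add: alpha_n_def divide_nonpos_nonneg)
    then show ?thesis using lim[OF x] by (intro LIMSEQ_le_const) auto
  qed
  show ?thesis unfolding hausdorff_dim_def
  proof (rule antisym)
    show "ereal s \<le> Inf {ereal t |t. 0 \<le> t \<and> hausdorff_measure dyadic_dist t A = 0}"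
      using low by (intro Inf_greatest) (auto simp: not_less[symmetric])
    show "Inf {ereal t |t. 0 \<le> t \<and> hausdorff_measure dyadic_dist t A = 0} \<le> ereal s"
    proof (rule ereal_le_epsilon2)
      fix e :: real assume "e > 0"
      then show "Inf {ereal t |t. 0 \<le> t \<and> hausdorff_measure dyadic_dist t A = 0} \<le> ereal s + ereal e"
        using up[of "s + e"] s0 by (intro Inf_lower) auto
    qed
  qed
qed

end

section \<open>The tilted Bernoulli product\<close>

lemma bernoulli_product_exists:
  fixes r :: "nat \<Rightarrow> real"
  assumes r: "\<And>j. 0 \<le> r j" "\<And>j. r j \<le> 1"
  shows "\<exists>\<nu>. symb_prob_space \<nu> \<and>
           (\<forall>w. measure \<nu> (cylinder w) = (\<Prod>j<length w. if w ! j then 1 - r j else r j))"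
proof -
  \<comment> \<open>\<open>r j\<close> is the weight of the symbol \<open>False\<close>, hence the parameter \<open>1 - r j\<close>.\<close>
  define M where "M j = measure_pmf (bernoulli_pmf (1 - r j))" for j
  interpret product_prob_space M UNIV
    by (rule product_prob_spaceI) (simp add: M_def prob_space_measure_pmf)
  let ?\<nu> = "PiM UNIV M"
  have cyl: "cylinder w = prod_emb UNIV M {..<length w} (\<Pi>\<^sub>E j\<in>{..<length w}. {w ! j})" for w
    by (auto simp: cylinder_def prod_emb_def M_def restrict_def PiE_iff extensional_def)
  have "symb_prob_space ?\<nu>"
  proof
    show "space ?\<nu> = UNIV" by (simp add: space_PiM M_def)
    show "cylinder w \<in> sets ?\<nu>" for w
      unfolding cyl by (rule sets_PiM_I) (auto simp: M_def)
  qed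
  moreover have "measure ?\<nu> (cylinder w) = (\<Prod>j<length w. if w ! j then 1 - r j else r j)" for w
  proof -
    have "measure ?\<nu> (cylinder w) = (\<Prod>j<length w. measure (M j) {w ! j})"
      unfolding cyl by (rule measure_PiM_emb) (auto simp: M_def)
    also have "\<dots> = (\<Prod>j<length w. if w ! j then 1 - r j else r j)"
    proof (rule prod.cong)
      fix j
      show "measure (M j) {w ! j} = (if w ! j then 1 - r j else r j)"
        using r[of j] by (cases "w ! j") (simp_all add: M_def measure_pmf_single)
    qed simp
    finally show ?thesis .
  qed
  ultimately show ?thesis by blast
qed

lemma bernoulli_product_UNIV:
  assumes "bernoulli_product \<mu>"
  shows "measure \<mu> UNIV = 1"
proof -
  have "measure \<mu> (cylinder []) = 1" using assms unfolding bernoulli_product_def by fastforce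
  then show ?thesis by (simp add: cylinder_def)
qed

lemma bernoulli_product_pos:
  assumes "bernoulli_product \<mu>" and "I \<in> cylinders n"
  shows "measure \<mu> I > 0"
proof -
  obtain w where w: "I = cylinder w" using assms(2) by (auto simp: cylinders_def)
  from assms(1) obtain p :: "nat \<Rightarrow> real" where p: "\<And>n. 0 < p n \<and> p n < 1"
    "\<And>w. measure \<mu> (cylinder w) =
               (\<Prod>j<length w. p j ^ (1 - of_bool (w ! j)) * (1 - p j) ^ of_bool (w ! j))"
    unfolding bernoulli_product_def by blast
  show ?thesis unfolding w p(2) using p(1) by (intro prod_pos) simp
qed

lemma bernoulli_product_le_1:
  assumes "bernoulli_product \<mu>"
  shows "measure \<mu> I \<le> 1"
proof -
  interpret prob_space \<mu> using assms by (simp add: bernoulli_product_def)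
  show ?thesis by simp
qed

text \<open>
  This holds for \<open>n = 0\<close> as well, where the sum is 1 and \<open>tau_n \<mu> 0 q = 0\<close> by division by zero.
\<close>

lemma partition_function_eq:
  assumes "bernoulli_product \<mu>"
  shows "(\<Sum>I\<in>cylinders n. measure \<mu> I powr q) = 2 powr (real n * tau_n \<mu> n q)"
proof (cases "n = 0")
  case True
  have "cylinders 0 = {UNIV}" by (auto simp: cylinders_def cylinder_def)
  then show ?thesis using True bernoulli_product_UNIV[OF assms] by simp
next
  case False
  have "0 < (\<Sum>I\<in>cylinders n. measure \<mu> I powr q)"
  proof (rule sum_pos)
    show "cylinders n \<noteq> {}" using cyl_at_in_cylinders[of n] by (metis empty_iff)
    show "0 < measure \<mu> I powr q" if "I \<in> cylinders n" for I
      using bernoulli_product_pos[OF assms that] by simp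
  qed (rule finite_cylinders)
  then show ?thesis using False
    by (simp add: tau_n_def powr_def)
qed

lemma tau_n_le_1:
  assumes "bernoulli_product \<mu>" and "q \<ge> 0"
  shows "tau_n \<mu> n q \<le> 1"
proof (cases "n = 0")
  case False
  have "2 powr (real n * tau_n \<mu> n q) \<le> (\<Sum>I\<in>cylinders n. 1)"
    unfolding partition_function_eq[OF assms(1), symmetric]
    using assms bernoulli_product_le_1[OF assms(1)] by (intro sum_mono) (simp add: powr_le1)
  also have "\<dots> \<le> real (2 ^ n)"
    using card_cylinders_le[of n] by (simp only: sum_constant mult_1_right of_nat_le_iff)
  also have "\<dots> = 2 powr (real n * 1)"
    by (simp add: powr_realpow)
  finally show ?thesis using False by simp
qed (simp add: tau_n_def)

text \<open>
  The measure \<open>\<nu>\<close> is the tilt of the Bernoulli product \<open>\<mu>\<close> with parameter \<open>q\<close>, described by its values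
  on cylinders only; this is all that is used of it.
\<close>

locale tilted_product = symb_prob_space \<nu> for \<nu> +
  fixes \<mu> :: "symb measure" and q :: real
  assumes bernoulli: "bernoulli_product \<mu>"
    and tilt: "I \<in> cylinders n \<Longrightarrow>
          measure \<nu> I = measure \<mu> I powr q / (\<Sum>J\<in>cylinders n. measure \<mu> J powr q)"

lemma tilted_product_exists:
  assumes "bernoulli_product \<mu>"
  shows "\<exists>\<nu>. tilted_product \<nu> \<mu> q"
proof -
  from assms obtain p :: "nat \<Rightarrow> real" where p: "\<And>n. 0 < p n \<and> p n < 1"
    "\<And>w. measure \<mu> (cylinder w) =
               (\<Prod>j<length w. p j ^ (1 - of_bool (w ! j)) * (1 - p j) ^ of_bool (w ! j))"
    unfolding bernoulli_product_def by blast
  define z where "z j = p j powr q + (1 - p j) powr q" for j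
  define r where "r j = p j powr q / z j" for j
  have z: "0 < z j" for j using p(1)[of j] by (simp add: z_def add_pos_pos)
  have r: "0 \<le> r j" "r j \<le> 1" "1 - r j = (1 - p j) powr q / z j" for j
    using z[of j] by (simp_all add: r_def divide_simps) (simp_all add: z_def)
  obtain \<nu> where \<nu>: "symb_prob_space \<nu>"
    "\<And>w. measure \<nu> (cylinder w) = (\<Prod>j<length w. if w ! j then 1 - r j else r j)"
    using bernoulli_product_exists[of r] r by metis
  have eq: "measure \<nu> (cylinder w) = measure \<mu> (cylinder w) powr q / (\<Prod>j<length w. z j)" for w
  proof -
    have "(\<Prod>j<length w. if w ! j then 1 - r j else r j)
        = (\<Prod>j<length w. (p j ^ (1 - of_bool (w ! j)) * (1 - p j) ^ of_bool (w ! j)) powr q / z j)"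
      by (intro prod.cong) (simp_all add: r(3), simp add: r_def)
    also have "\<dots> = (\<Prod>j<length w. (p j ^ (1 - of_bool (w ! j)) * (1 - p j) ^ of_bool (w ! j))) powr q / (\<Prod>j<length w. z j)"
      using p(1) by (simp add: prod_dividef prod_powr_distrib less_imp_le)
    finally show ?thesis by (simp only: \<nu>(2) p(2))
  qed
  interpret symb_prob_space \<nu> by (fact \<nu>(1))
  have "tilted_product \<nu> \<mu> q"
  proof
    fix I n assume I: "I \<in> cylinders n"
    have eqI: "measure \<nu> J = measure \<mu> J powr q / (\<Prod>j<n. z j)" if "J \<in> cylinders n" for J
      using that eq by (auto simp: cylinders_def)
    \<comment> \<open>Total mass 1 of \<open>\<nu>\<close> identifies the product of the normalising factors with the sum.\<close>
    have "1 = (\<Sum>J\<in>cylinders n. measure \<mu> J powr q / (\<Prod>j<n. z j))"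
      using sum_measure_cylinders[of n] eqI by (simp cong: sum.cong)
    also have "\<dots> = (\<Sum>J\<in>cylinders n. measure \<mu> J powr q) / (\<Prod>j<n. z j)"
      by (simp add: sum_divide_distrib)
    finally have "(\<Sum>J\<in>cylinders n. measure \<mu> J powr q) = (\<Prod>j<n. z j)"
      using z by (simp add: divide_simps split: if_splits)
    then show "measure \<nu> I = measure \<mu> I powr q / (\<Sum>J\<in>cylinders n. measure \<mu> J powr q)"
      using eqI[OF I] by simp
  qed (rule assms)
  then show ?thesis ..
qed

context tilted_product
begin

lemma measure_mu_cyl_at: "measure \<mu> (cyl_at n x) = 2 powr (- (real n * alpha_n \<mu> n x))"
  by (intro measure_cyl_at_alpha_n bernoulli_product_UNIV[OF bernoulli]
      bernoulli_product_pos[OF bernoulli cyl_at_in_cylinders])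

lemma measure_cyl_at:
  "measure \<nu> (cyl_at n x) = 2 powr (- (real n * (q * alpha_n \<mu> n x + tau_n \<mu> n q)))"
proof -
  have "measure \<nu> (cyl_at n x)
      = (2 powr (- (real n * alpha_n \<mu> n x))) powr q / 2 powr (real n * tau_n \<mu> n q)"
    by (simp add: tilt[OF cyl_at_in_cylinders] partition_function_eq[OF bernoulli] measure_mu_cyl_at)
  also have "\<dots> = 2 powr (- (real n * (q * alpha_n \<mu> n x + tau_n \<mu> n q)))"
    unfolding powr_powr powr_diff[symmetric] by (rule arg_cong[of _ _ "(powr) 2"]) algebra
  finally show ?thesis .
qed

lemma alpha_n_tilted: "alpha_n \<nu> n x = q * alpha_n \<mu> n x + tau_n \<mu> n q"
proof (cases "n = 0")
  case False
  have "measure \<nu> (cyl_at n x) = 2 powr (- (real n * alpha_n \<nu> n x))"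
    using prob_space by (intro measure_cyl_at_alpha_n) (simp_all add: measure_cyl_at space_symb)
  then have "q * alpha_n \<mu> n x + tau_n \<mu> n q = alpha_n \<nu> n x"
    using False by (simp add: measure_cyl_at powr_inj)
  then show ?thesis by simp
qed (simp add: alpha_n_def tau_n_def)

lemma Collect_alpha_n_sets: "{x. P (alpha_n \<mu> n x)} \<in> sets \<nu>"
  unfolding alpha_n_def by (rule Collect_cyl_at_sets)

text \<open>
  Markov's inequality for \<open>\<mu> I powr t\<close> under \<open>\<nu>\<close>, with either sign of \<open>t\<close>: negative \<open>t\<close> controls large
  values of \<open>alpha_n\<close>, positive \<open>t\<close> small ones.
\<close>

lemma chernoff:
  "measure \<nu> {x. t * alpha_n \<mu> n x \<le> b} \<le> 2 powr (real n * (tau_n \<mu> n (q + t) - tau_n \<mu> n q + b))"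
proof -
  define a where "a I = - (ln (measure \<mu> I) / (real n * ln 2))" for I
  have a: "a (cyl_at n x) = alpha_n \<mu> n x" for x by (simp add: a_def alpha_n_def)
  let ?f = "\<lambda>I. measure \<mu> I powr (q + t) * 2 powr (real n * (b - tau_n \<mu> n q))"
  have "measure \<nu> {x. t * alpha_n \<mu> n x \<le> b} = (\<Sum>I | I \<in> cylinders n \<and> t * a I \<le> b. measure \<nu> I)"
    using measure_Collect_cyl_at[of "\<lambda>I. t * a I \<le> b" n] by (simp add: a)
  also have "\<dots> \<le> (\<Sum>I | I \<in> cylinders n \<and> t * a I \<le> b. ?f I)"
  proof (rule sum_mono)
    fix I assume I: "I \<in> {I. I \<in> cylinders n \<and> t * a I \<le> b}"
    then obtain x where x: "I = cyl_at n x" using cylinders_D by blast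
    have "real n * (t * alpha_n \<mu> n x) \<le> real n * b" using I by (intro mult_left_mono) (auto simp: x a)
    then show "measure \<nu> I \<le> ?f I"
      by (simp add: x measure_cyl_at measure_mu_cyl_at powr_powr algebra_simps flip: powr_add)
  qed
  also have "\<dots> \<le> (\<Sum>I\<in>cylinders n. ?f I)"
    by (rule sum_mono2) (auto simp: finite_cylinders)
  also have "\<dots> = 2 powr (real n * tau_n \<mu> n (q + t)) * 2 powr (real n * (b - tau_n \<mu> n q))"
    by (simp add: partition_function_eq[OF bernoulli] flip: sum_distrib_right)
  also have "\<dots> = 2 powr (real n * (tau_n \<mu> n (q + t) - tau_n \<mu> n q + b))"
    by (simp add: algebra_simps flip: powr_add)
  finally show ?thesis .
qed

text \<open>
  Only an upper bound for \<open>tau_n \<mu> n (q + t)\<close> enters, and this is what the upper limit \<open>tau\<close> provides;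
  convergence of \<open>tau_n\<close> is needed at \<open>q\<close> alone, where a lower bound is used.
\<close>

lemma deviation_decay:
  assumes q: "q > 0" and lim: "(\<lambda>n. tau_n \<mu> n q) \<longlonglongrightarrow> T"
    and der: "(tau_real \<mu> has_real_derivative - \<alpha>) (at q)" and \<epsilon>: "\<epsilon> > 0"
  shows "\<exists>\<kappa>>0. \<forall>\<^sub>F n in sequentially.
           measure \<nu> {x. \<epsilon> \<le> \<bar>alpha_n \<mu> n x - \<alpha>\<bar>} \<le> 2 * 2 powr (- real n * \<kappa>)"
proof -
  have tau_q: "tau_real \<mu> q = T"
    using lim_imp_Limsup[OF _ tendsto_ereal[OF lim]] by (simp add: tau_real_def tau_def)
  have "((\<lambda>h. (tau_real \<mu> (q + h) - tau_real \<mu> q) / h) \<longlongrightarrow> - \<alpha>) (at 0)"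
    using der by (simp add: DERIV_def)
  then obtain d where d: "d > 0"
    and slope: "\<And>h. h \<noteq> 0 \<Longrightarrow> \<bar>h\<bar> < d \<Longrightarrow> \<bar>(tau_real \<mu> (q + h) - tau_real \<mu> q) / h + \<alpha>\<bar> < \<epsilon> / 4"
    using LIM_D[of "\<lambda>h. (tau_real \<mu> (q + h) - tau_real \<mu> q) / h" "- \<alpha>" 0 "\<epsilon> / 4"] \<epsilon> by auto
  define t where "t = min d q / 2"
  have t: "0 < t" "t < d" "t < q" using d q by (auto simp: t_def min_def)
  define \<kappa> where "\<kappa> = \<epsilon> * t / 4"
  have \<kappa>: "\<kappa> > 0" using \<epsilon> t by (simp add: \<kappa>_def)
  \<comment> \<open>In Chernoff's exponent the deviation contributes \<open>- \<epsilon> * t = - 4 * \<kappa>\<close>; the derivative and the two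
    limits each lose \<open>\<kappa>\<close>, so \<open>- \<kappa>\<close> remains.\<close>
  have one_sided: "\<forall>\<^sub>F n in sequentially.
      measure \<nu> {x. h * alpha_n \<mu> n x \<le> h * \<alpha> - \<epsilon> * t} \<le> 2 powr (- real n * \<kappa>)"
    if h: "\<bar>h\<bar> = t" for h
  proof -
    have "\<bar>h\<bar> * \<bar>(tau_real \<mu> (q + h) - T) / h + \<alpha>\<bar> \<le> t * (\<epsilon> / 4)"
      using slope[of h] h t by (intro mult_mono) (auto simp: tau_q)
    moreover have "\<bar>h\<bar> * \<bar>(tau_real \<mu> (q + h) - T) / h + \<alpha>\<bar> = \<bar>tau_real \<mu> (q + h) - T + h * \<alpha>\<bar>"
    proof -
      have "h * ((tau_real \<mu> (q + h) - T) / h + \<alpha>) = tau_real \<mu> (q + h) - T + h * \<alpha>"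
        using h t by (simp add: distrib_left)
      then show ?thesis by (simp only: abs_mult[symmetric])
    qed
    moreover have "t * (\<epsilon> / 4) = \<kappa>" by (simp add: \<kappa>_def)
    ultimately have "\<bar>tau_real \<mu> (q + h) - T + h * \<alpha>\<bar> \<le> \<kappa>" by metis
    then have chord: "tau_real \<mu> (q + h) \<le> T - h * \<alpha> + \<kappa>" by linarith
    \<comment> \<open>\<open>tau_real\<close> would be \<open>0\<close> at a point where \<open>tau\<close> is infinite; excluding \<open>\<infinity>\<close> is enough for the
      upper bound by \<open>tau_real\<close>, and it follows from \<open>q + h > 0\<close>.\<close>
    have "tau \<mu> (q + h) \<le> 1"
      unfolding tau_def using h t tau_n_le_1[OF bernoulli, of "q + h"]
      by (intro Limsup_bounded) (auto simp: one_ereal_def)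
    then have "tau \<mu> (q + h) \<le> ereal (tau_real \<mu> (q + h))"
      unfolding tau_real_def by (cases "tau \<mu> (q + h)") auto
    also have "\<dots> < ereal (tau_real \<mu> (q + h) + \<kappa>)" using \<kappa> by simp
    finally have "\<forall>\<^sub>F n in sequentially. ereal (tau_n \<mu> n (q + h)) < ereal (tau_real \<mu> (q + h) + \<kappa>)"
      unfolding tau_def by (rule Limsup_lessD)
    moreover have "\<forall>\<^sub>F n in sequentially. T - \<kappa> < tau_n \<mu> n q"
      using lim \<kappa> by (intro order_tendstoD) auto
    ultimately show ?thesis
    proof eventually_elim
      case (elim n)
      have "tau_n \<mu> n (q + h) - tau_n \<mu> n q + (h * \<alpha> - \<epsilon> * t) \<le> - \<kappa>"
        using elim chord by (simp add: \<kappa>_def)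
      then have "real n * (tau_n \<mu> n (q + h) - tau_n \<mu> n q + (h * \<alpha> - \<epsilon> * t)) \<le> real n * - \<kappa>"
        by (rule mult_left_mono) simp
      then show ?case
        using chernoff[of h n "h * \<alpha> - \<epsilon> * t"]
        by (elim order_trans) simp
    qed
  qed
  have one_sided_t: "\<forall>\<^sub>F n in sequentially.
      measure \<nu> {x. t * alpha_n \<mu> n x \<le> t * \<alpha> - \<epsilon> * t} \<le> 2 powr (- real n * \<kappa>)"
    and one_sided_neg: "\<forall>\<^sub>F n in sequentially.
      measure \<nu> {x. - t * alpha_n \<mu> n x \<le> - t * \<alpha> - \<epsilon> * t} \<le> 2 powr (- real n * \<kappa>)"
    by (rule one_sided; use t in simp)+
  have "\<forall>\<^sub>F n in sequentially. measure \<nu> {x. \<epsilon> \<le> \<bar>alpha_n \<mu> n x - \<alpha>\<bar>} \<le> 2 * 2 powr (- real n * \<kappa>)"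
    using one_sided_t one_sided_neg
  proof eventually_elim
    case (elim n)
    let ?L = "{x. t * alpha_n \<mu> n x \<le> t * \<alpha> - \<epsilon> * t}"
      and ?R = "{x. - t * alpha_n \<mu> n x \<le> - t * \<alpha> - \<epsilon> * t}"
    have sets: "?L \<in> sets \<nu>" "?R \<in> sets \<nu>" by (rule Collect_alpha_n_sets)+
    have "{x. \<epsilon> \<le> \<bar>alpha_n \<mu> n x - \<alpha>\<bar>} \<subseteq> ?L \<union> ?R"
    proof
      fix x assume "x \<in> {x. \<epsilon> \<le> \<bar>alpha_n \<mu> n x - \<alpha>\<bar>}"
      then consider "alpha_n \<mu> n x \<le> \<alpha> - \<epsilon>" | "\<alpha> + \<epsilon> \<le> alpha_n \<mu> n x" by fastforce
      then show "x \<in> ?L \<union> ?R"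
      proof cases
        case 1
        then have "t * alpha_n \<mu> n x \<le> t * (\<alpha> - \<epsilon>)" using t by (intro mult_left_mono) auto
        then show ?thesis by (simp add: algebra_simps)
      next
        case 2
        then have "t * (\<alpha> + \<epsilon>) \<le> t * alpha_n \<mu> n x" using t by (intro mult_left_mono) auto
        then show ?thesis by (simp add: algebra_simps)
      qed
    qed
    then have "measure \<nu> {x. \<epsilon> \<le> \<bar>alpha_n \<mu> n x - \<alpha>\<bar>} \<le> measure \<nu> (?L \<union> ?R)"
      using sets by (intro finite_measure_mono) auto
    also have "\<dots> \<le> measure \<nu> ?L + measure \<nu> ?R"
      using sets by (intro measure_subadditive) auto
    finally show ?case using elim by simp
  qed
  then show ?thesis using \<kappa> by blast
qed

lemma AE_alpha_n_tendsto:
  assumes "q > 0" and "(\<lambda>n. tau_n \<mu> n q) \<longlonglongrightarrow> T"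
    and "(tau_real \<mu> has_real_derivative - \<alpha>) (at q)"
  shows "AE x in \<nu>. (\<lambda>n. alpha_n \<mu> n x) \<longlonglongrightarrow> \<alpha>"
proof -
  have "AE x in \<nu>. \<forall>\<^sub>F n in sequentially. \<bar>alpha_n \<mu> n x - \<alpha>\<bar> < \<epsilon>" if \<epsilon>: "\<epsilon> > 0" for \<epsilon>
  proof -
    let ?B = "\<lambda>n. {x. \<epsilon> \<le> \<bar>alpha_n \<mu> n x - \<alpha>\<bar>}"
    obtain \<kappa> where \<kappa>: "\<kappa> > 0"
      "\<forall>\<^sub>F n in sequentially. measure \<nu> (?B n) \<le> 2 * 2 powr (- real n * \<kappa>)"
      using deviation_decay[OF assms \<epsilon>] by blast
    have "2 powr (- \<kappa>) < 1" using \<kappa>(1) powr_less_mono[of "- \<kappa>" 0 2] by simp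
    then have "summable (\<lambda>n. 2 * (2 powr (- \<kappa>)) ^ n)"
      by (intro summable_mult summable_geometric) simp
    then have "summable (\<lambda>n. 2 * 2 powr (- real n * \<kappa>))"
      by (simp add: powr_powr mult.commute flip: powr_realpow)
    then have "summable (\<lambda>n. measure \<nu> (?B n))"
      by (rule summable_comparison_test_ev[rotated]) (use \<kappa>(2) in \<open>eventually_elim, simp\<close>)
    then have "AE x in \<nu>. \<forall>\<^sub>F n in sequentially. x \<in> space \<nu> - ?B n"
      by (intro borel_cantelli_AE1 Collect_alpha_n_sets) (simp_all add: emeasure_eq_measure)
    then show ?thesis by (simp add: space_symb not_le)
  qed
  then have "AE x in \<nu>. \<forall>k::nat. \<forall>\<^sub>F n in sequentially. \<bar>alpha_n \<mu> n x - \<alpha>\<bar> < 1 / real (Suc k)"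
    by (simp add: AE_all_countable)
  then show ?thesis
  proof eventually_elim
    case (elim x)
    show ?case
    proof (rule tendstoI)
      fix e :: real assume "e > 0"
      then obtain k where k: "1 / real (Suc k) < e" using nat_approx_posE by blast
      from elim have "\<forall>\<^sub>F n in sequentially. \<bar>alpha_n \<mu> n x - \<alpha>\<bar> < 1 / real (Suc k)" ..
      then show "\<forall>\<^sub>F n in sequentially. dist (alpha_n \<mu> n x) \<alpha> < e"
        by eventually_elim (use k in \<open>simp add: dist_real_def\<close>)
    qed
  qed
qed

text \<open>
  The sum of the \<open>q'\<close>-th powers is restricted to the cylinders with \<open>\<bar>alpha_n \<mu> n x - \<alpha>\<bar> < \<epsilon>\<close>, where
  \<open>\<mu> I powr q'\<close> is bounded below by a multiple of \<open>\<nu> I\<close>; the term \<open>1 / n\<close> comes from the mass \<open>1/2\<close> left.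
\<close>

lemma tau_n_lower_bound:
  assumes n: "n > 0" and half: "measure \<nu> {x. \<epsilon> \<le> \<bar>alpha_n \<mu> n x - \<alpha>\<bar>} \<le> 1 / 2"
  shows "tau_n \<mu> n q - \<alpha> * (q' - q) - \<epsilon> * \<bar>q' - q\<bar> - 1 / real n \<le> tau_n \<mu> n q'"
proof -
  define a where "a I = - (ln (measure \<mu> I) / (real n * ln 2))" for I
  have a: "a (cyl_at n x) = alpha_n \<mu> n x" for x by (simp add: a_def alpha_n_def)
  define c where "c = tau_n \<mu> n q - \<alpha> * (q' - q) - \<epsilon> * \<bar>q' - q\<bar>"
  let ?G = "{I \<in> cylinders n. \<bar>a I - \<alpha>\<bar> < \<epsilon>}"
  have "{x. \<bar>alpha_n \<mu> n x - \<alpha>\<bar> < \<epsilon>} = space \<nu> - {x. \<epsilon> \<le> \<bar>alpha_n \<mu> n x - \<alpha>\<bar>}"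
    by (auto simp: space_symb)
  then have "measure \<nu> {x. \<bar>alpha_n \<mu> n x - \<alpha>\<bar> < \<epsilon>} = 1 - measure \<nu> {x. \<epsilon> \<le> \<bar>alpha_n \<mu> n x - \<alpha>\<bar>}"
    by (simp only: prob_compl[OF Collect_alpha_n_sets[of "\<lambda>a. \<epsilon> \<le> \<bar>a - \<alpha>\<bar>"]])
  then have "1 / 2 \<le> measure \<nu> {x. \<bar>alpha_n \<mu> n x - \<alpha>\<bar> < \<epsilon>}" using half by simp
  also have "\<dots> = (\<Sum>I\<in>?G. measure \<nu> I)"
    using measure_Collect_cyl_at[of "\<lambda>I. \<bar>a I - \<alpha>\<bar> < \<epsilon>" n] by (simp add: a)
  also have "\<dots> \<le> (\<Sum>I\<in>?G. measure \<mu> I powr q' * 2 powr (- (real n * c)))"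
  proof (rule sum_mono)
    fix I assume I: "I \<in> ?G"
    then obtain x where x: "I = cyl_at n x" using cylinders_D by blast
    have "(alpha_n \<mu> n x - \<alpha>) * (q' - q) \<le> \<bar>alpha_n \<mu> n x - \<alpha>\<bar> * \<bar>q' - q\<bar>"
      by (metis abs_ge_self abs_mult)
    also have "\<dots> \<le> \<epsilon> * \<bar>q' - q\<bar>" using I by (intro mult_right_mono) (auto simp: x a)
    finally have "alpha_n \<mu> n x * q' + c \<le> q * alpha_n \<mu> n x + tau_n \<mu> n q"
      by (simp add: c_def algebra_simps)
    then have "real n * (alpha_n \<mu> n x * q' + c) \<le> real n * (q * alpha_n \<mu> n x + tau_n \<mu> n q)"
      by (rule mult_left_mono) simp
    then show "measure \<nu> I \<le> measure \<mu> I powr q' * 2 powr (- (real n * c))"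
      by (simp add: x measure_cyl_at measure_mu_cyl_at powr_powr algebra_simps flip: powr_add)
  qed
  also have "\<dots> \<le> (\<Sum>I\<in>cylinders n. measure \<mu> I powr q' * 2 powr (- (real n * c)))"
    by (rule sum_mono2) (auto simp: finite_cylinders)
  also have "\<dots> = 2 powr (real n * tau_n \<mu> n q' - real n * c)"
    by (simp add: partition_function_eq[OF bernoulli] flip: sum_distrib_right powr_add)
  finally have "2 powr (-1) \<le> 2 powr (real n * tau_n \<mu> n q' - real n * c)"
    by (simp add: powr_minus)
  then have "- 1 \<le> real n * tau_n \<mu> n q' - real n * c"
    by (subst (asm) powr_le_cancel_iff) simp_all
  then have "- 1 \<le> real n * (tau_n \<mu> n q' - c)" by (simp only: right_diff_distrib)
  then have "c - 1 / real n \<le> tau_n \<mu> n q'" using n by (simp add: field_simps)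
  then show ?thesis by (simp add: c_def)
qed

text \<open>The tangent inequality holds for every real \<open>q'\<close>, also where \<open>tau \<mu> q'\<close> is infinite.\<close>

lemma tau_tangent:
  assumes "q > 0" and lim: "(\<lambda>n. tau_n \<mu> n q) \<longlonglongrightarrow> T"
    and "(tau_real \<mu> has_real_derivative - \<alpha>) (at q)"
  shows "ereal (T - \<alpha> * (q' - q)) \<le> tau \<mu> q'"
proof (rule ereal_le_epsilon2)
  fix e :: real assume e: "e > 0"
  define \<epsilon> where "\<epsilon> = e / (\<bar>q' - q\<bar> + 2)"
  have \<epsilon>: "\<epsilon> > 0" "\<epsilon> * \<bar>q' - q\<bar> + 2 * \<epsilon> = e"
  proof -
    show "\<epsilon> > 0" using e by (simp add: \<epsilon>_def)
    have "\<epsilon> * (\<bar>q' - q\<bar> + 2) = e" by (simp add: \<epsilon>_def add_nonneg_eq_0_iff)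
    then show "\<epsilon> * \<bar>q' - q\<bar> + 2 * \<epsilon> = e" by (simp add: algebra_simps)
  qed
  obtain \<kappa> where \<kappa>: "\<kappa> > 0" and decay: "\<forall>\<^sub>F n in sequentially.
      measure \<nu> {x. \<epsilon> \<le> \<bar>alpha_n \<mu> n x - \<alpha>\<bar>} \<le> 2 * 2 powr (- real n * \<kappa>)"
    using deviation_decay[OF assms \<epsilon>(1)] by blast
  have "(\<lambda>n. 2 * (2 powr (- \<kappa>)) ^ n) \<longlonglongrightarrow> 2 * 0"
    using \<kappa> powr_less_mono[of "- \<kappa>" 0 2] by (intro tendsto_mult_left LIMSEQ_realpow_zero) simp_all
  then have "(\<lambda>n. 2 * 2 powr (- real n * \<kappa>)) \<longlonglongrightarrow> 0"
    by (simp add: powr_powr mult.commute flip: powr_realpow)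
  then have "\<forall>\<^sub>F n in sequentially. 2 * 2 powr (- real n * \<kappa>) < 1 / 2"
    by (rule order_tendstoD) simp
  moreover note decay
  moreover have "\<forall>\<^sub>F n in sequentially. T - \<epsilon> < tau_n \<mu> n q"
    using lim \<epsilon> by (intro order_tendstoD) auto
  moreover have "\<forall>\<^sub>F n in sequentially. 1 / real n < \<epsilon>"
    using lim_1_over_n \<epsilon>(1) by (rule order_tendstoD)
  moreover have "\<forall>\<^sub>F n in sequentially. n > (0::nat)" by (rule eventually_gt_at_top)
  ultimately have "\<forall>\<^sub>F n in sequentially. ereal (T - \<alpha> * (q' - q) - e) \<le> ereal (tau_n \<mu> n q')"
  proof eventually_elim
    case (elim n)
    have "tau_n \<mu> n q - \<alpha> * (q' - q) - \<epsilon> * \<bar>q' - q\<bar> - 1 / real n \<le> tau_n \<mu> n q'"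
      using elim by (intro tau_n_lower_bound) auto
    then show ?case using elim(3,4) \<epsilon>(2) by simp
  qed
  then have "ereal (T - \<alpha> * (q' - q) - e) \<le> tau \<mu> q'"
    unfolding tau_def by (rule le_Limsup[rotated]) simp
  then show "ereal (T - \<alpha> * (q' - q)) \<le> tau \<mu> q' + ereal e"
    by (cases "tau \<mu> q'") auto
qed

end

section \<open>Dimension of the level set\<close>

lemma E_set_Int_F_set: "E_set \<mu> \<alpha> \<inter> F_set \<mu> \<alpha> = {x. (\<lambda>n. alpha_n \<mu> n x) \<longlonglongrightarrow> \<alpha>}"
proof -
  have "(\<lambda>n. alpha_n \<mu> n x) \<longlonglongrightarrow> \<alpha>
      \<longleftrightarrow> liminf (\<lambda>n. ereal (alpha_n \<mu> n x)) = ereal \<alpha> \<and> limsup (\<lambda>n. ereal (alpha_n \<mu> n x)) = ereal \<alpha>" for x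
    using tendsto_iff_Liminf_eq_Limsup[of sequentially "\<lambda>n. ereal (alpha_n \<mu> n x)" "ereal \<alpha>"]
    by auto
  then show ?thesis by (auto simp: E_set_def F_set_def)
qed

theorem theorem1p2:
  fixes \<mu> :: "symb measure" and q \<alpha> :: real
  assumes "bernoulli_product \<mu>"
    and "q > 0"
    and "convergent (\<lambda>n. tau_n \<mu> n q)"
    and "tau_real \<mu> differentiable (at q)"
    and "\<alpha> = - deriv (tau_real \<mu>) q"
  shows "hausdorff_dim dyadic_dist (E_set \<mu> \<alpha> \<inter> F_set \<mu> \<alpha>) = legendre (tau \<mu>) \<alpha>
       \<and> legendre (tau \<mu>) \<alpha> = ereal (\<alpha> * q) + tau \<mu> q"
proof -
  obtain T where T: "(\<lambda>n. tau_n \<mu> n q) \<longlonglongrightarrow> T"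
    using assms(3) by (auto simp: convergent_def)
  have tau_q: "tau \<mu> q = ereal T"
    unfolding tau_def using T by (intro lim_imp_Limsup) auto
  have der: "(tau_real \<mu> has_real_derivative - \<alpha>) (at q)"
    using assms(4,5) by (auto simp: real_differentiable_def dest: DERIV_imp_deriv)
  obtain \<nu> where "tilted_product \<nu> \<mu> q"
    using tilted_product_exists[OF assms(1)] by blast
  then interpret tilted_product \<nu> \<mu> q .
  have legendre_eq: "legendre (tau \<mu>) \<alpha> = ereal (\<alpha> * q + T)"
  proof (rule antisym)
    have "legendre (tau \<mu>) \<alpha> \<le> ereal (\<alpha> * q) + tau \<mu> q"
      unfolding legendre_def by (rule INF_lower) simp
    then show "legendre (tau \<mu>) \<alpha> \<le> ereal (\<alpha> * q + T)" by (simp add: tau_q)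
    show "ereal (\<alpha> * q + T) \<le> legendre (tau \<mu>) \<alpha>"
      unfolding legendre_def
    proof (rule INF_greatest)
      fix q'
      have "ereal (\<alpha> * q + T) = ereal (\<alpha> * q') + ereal (T - \<alpha> * (q' - q))"
        by (simp add: algebra_simps)
      also have "\<dots> \<le> ereal (\<alpha> * q') + tau \<mu> q'"
        using tau_tangent[OF assms(2) T der] by (rule add_left_mono)
      finally show "ereal (\<alpha> * q + T) \<le> ereal (\<alpha> * q') + tau \<mu> q'" .
    qed
  qed
  have "hausdorff_dim dyadic_dist (E_set \<mu> \<alpha> \<inter> F_set \<mu> \<alpha>) = ereal (\<alpha> * q + T)"
    unfolding E_set_Int_F_set
  proof (rule hausdorff_dim_eq_local_dim)
    show "measure \<nu> (cyl_at n x) > 0" for n x by (simp add: measure_cyl_at)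
    show "AE x in \<nu>. x \<in> {x. (\<lambda>n. alpha_n \<mu> n x) \<longlonglongrightarrow> \<alpha>}"
      using AE_alpha_n_tendsto[OF assms(2) T der] by simp
    show "(\<lambda>n. alpha_n \<nu> n x) \<longlonglongrightarrow> \<alpha> * q + T" if "x \<in> {x. (\<lambda>n. alpha_n \<mu> n x) \<longlonglongrightarrow> \<alpha>}" for x
      unfolding alpha_n_tilted using that T by (auto intro!: tendsto_eq_intros)
  qed
  then show ?thesis by (simp add: legendre_eq tau_q)
qed

end
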